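(* Let $K$ be a $\mathbb{Z}/2\mathbb{Z}$-pure global knot diagram in $T^2\times\mathbb{R}$ with respect to $v$ which is not isotopic to a knot contained in $T^2\times\{0\}$, which has at least one crossing, and which is minimal, i.e. no Reidemeister move of type II decreasing the number of crossings can be performed on it. Then $pr(K)$ contains a 2-gon: there are two distinct crossings $q_1,q_2$ and two arcs of $pr(K)$, each joining $q_1$ to $q_2$, whose union is a null-homotopic loop in $T^2$.
   Context: $T^2=\mathbb{R}^2/\mathbb{Z}^2$ with fixed generators $\alpha,\beta$ of $H_1(T^2;\mathbb{Z})$; $v$ is the constant unit vector field on $T^2$ tangent to the fibres of a linear submersion $f:T^2\to S^1$ whose fibres represent $\beta$; $pr:T^2\times\mathbb{R}\to T^2$ is the projection. A knot diagram is a smooth oriented knot $K\subset T^2\times\mathbb{R}$ such that $pr|_K$ is an immersion whose only multiple points are transverse double points, called crossings. $K$ is global (with respect to $v$) if $pr(K)$ is everywhere transverse to $v$; it is oriented so that (tangent vector of $pr(K)$, $v$) is a positively oriented basis of $T^2$. For a crossing $p$, smoothing $pr(K)$ at $p$ respecting orientations yields two oriented loops $K_p^+,K_p^-$ with $[K_p^+]+[K_p^-]=[K]$ in $H_1(T^2;\mathbb{Z})$. A global knot diagram $K$ is $\mathbb{Z}/2\mathbb{Z}$-pure if (1) $H_1(T^2;\mathbb{Z})/\langle[K]\rangle\cong\mathbb{Z}$, and (2) for every crossing $p$ the class of $K_p^+$ (equivalently of $K_p^-$) is nonzero in $G=(H_1(T^2;\mathbb{Z})/\langle[K]\rangle)\otimes\mathbb{Z}/2\mathbb{Z}\cong\mathbb{Z}/2\mathbb{Z}$.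 *)

theory Defs
  imports "HOL-Analysis.Analysis" "HOL-Algebra.Algebra"
begin

fun Ck :: "nat \<Rightarrow> ('a::real_normed_vector \<Rightarrow> 'b::real_normed_vector) \<Rightarrow> bool" where
  "Ck 0 f = continuous_on UNIV f"
| "Ck (Suc k) f = (\<exists>f'. (\<forall>x. (f has_derivative f' x) (at x)) \<and> (\<forall>v. Ck k (\<lambda>x. f' x v)))"

definition smooth :: "('a::real_normed_vector \<Rightarrow> 'b::real_normed_vector) \<Rightarrow> bool" where
  "smooth f \<longleftrightarrow> (\<forall>k. Ck k f)"

definition tor_eq :: "real \<times> real \<Rightarrow> real \<times> real \<Rightarrow> bool" where
  "tor_eq p q \<longleftrightarrow> fst p - fst q \<in> \<int> \<and> snd p - snd q \<in> \<int>"

text \<open>A knot K in T^2 x R is given by a lift t |-> (x t, y t, z t) to R^2 x R of a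
  1-periodic parametrisation of S^1 = R/Z; (a,b) = [K] in H_1(T^2) = Z^2 w.r.t. the
  fixed generators alpha = (1,0), beta = (0,1).\<close>
definition knot_embedding :: "(real \<Rightarrow> real) \<Rightarrow> (real \<Rightarrow> real) \<Rightarrow> (real \<Rightarrow> real) \<Rightarrow> int \<Rightarrow> int \<Rightarrow> bool" where
  "knot_embedding x y z a b \<longleftrightarrow>
     smooth x \<and> smooth y \<and> smooth z \<and>
     (\<forall>t. x (t + 1) = x t + of_int a \<and> y (t + 1) = y t + of_int b \<and> z (t + 1) = z t) \<and>
     (\<forall>t. (deriv x t, deriv y t, deriv z t) \<noteq> 0) \<and>
     (\<forall>s t. tor_eq (x s, y s) (x t, y t) \<and> z s = z t \<longrightarrow> s - t \<in> \<int>)"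

text \<open>s, t are the two preimages of a crossing of pr(K).\<close>
definition is_crossing :: "(real \<Rightarrow> real) \<Rightarrow> (real \<Rightarrow> real) \<Rightarrow> real \<Rightarrow> real \<Rightarrow> bool" where
  "is_crossing x y s t \<longleftrightarrow> tor_eq (x s, y s) (x t, y t) \<and> s - t \<notin> \<int>"

text \<open>Global w.r.t. v = (0,1) (tangent to the fibres of f(u1,u2) = u1, which represent beta):
  pr(K) transverse to v and (tangent, v) positively oriented, i.e. x' > 0.\<close>
definition global_knot_diagram :: "(real \<Rightarrow> real) \<Rightarrow> (real \<Rightarrow> real) \<Rightarrow> (real \<Rightarrow> real) \<Rightarrow> int \<Rightarrow> int \<Rightarrow> bool" where
  "global_knot_diagram x y z a b \<longleftrightarrow>
     knot_embedding x y z a b \<and>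
     (\<forall>t. (deriv x t, deriv y t) \<noteq> 0) \<and>
     (\<forall>r s t. tor_eq (x r, y r) (x s, y s) \<and> tor_eq (x s, y s) (x t, y t) \<longrightarrow>
              r - s \<in> \<int> \<or> s - t \<in> \<int> \<or> r - t \<in> \<int>) \<and>
     (\<forall>s t. is_crossing x y s t \<longrightarrow> deriv x s * deriv y t - deriv y s * deriv x t \<noteq> 0) \<and>
     (\<forall>t. deriv x t > 0)"

abbreviation Z2grp :: "(int \<times> int) monoid" where
  "Z2grp \<equiv> DirProd integer_group integer_group"

text \<open>A class (m,n) in H_1 = Z^2 is nonzero in (Z^2/<(a,b)>) \<otimes> Z/2 = Z^2/(<(a,b)> + 2 Z^2).\<close>
definition nonzero_in_G :: "int \<Rightarrow> int \<Rightarrow> int \<Rightarrow> int \<Rightarrow> bool" where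
  "nonzero_in_G a b m n \<longleftrightarrow> \<not> (\<exists>k::int. even (m - k * a) \<and> even (n - k * b))"

text \<open>For a crossing with preimages s, t, the smoothed loop K_p^+ is pr(K) restricted to
  the parameter interval from s to t; its class is (x t - x s, y t - y s).\<close>
definition Z2_pure :: "(real \<Rightarrow> real) \<Rightarrow> (real \<Rightarrow> real) \<Rightarrow> int \<Rightarrow> int \<Rightarrow> bool" where
  "Z2_pure x y a b \<longleftrightarrow>
     (Z2grp Mod (generate Z2grp {(a, b)})) \<cong> integer_group \<and>
     (\<forall>s t m n. is_crossing x y s t \<and> x t - x s = of_int m \<and> y t - y s = of_int n
                 \<longrightarrow> nonzero_in_G a b m n)"

definition isotopic_to_flat :: "(real \<Rightarrow> real) \<Rightarrow> (real \<Rightarrow> real) \<Rightarrow> (real \<Rightarrow> real) \<Rightarrow> int \<Rightarrow> int \<Rightarrow> bool" where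
  "isotopic_to_flat x y z a b \<longleftrightarrow>
     (\<exists>(H1::real \<times> real \<Rightarrow> real) (H2::real \<times> real \<Rightarrow> real) (H3::real \<times> real \<Rightarrow> real).
        smooth H1 \<and> smooth H2 \<and> smooth H3 \<and>
        (\<forall>s \<in> {0..1}. knot_embedding (\<lambda>t. H1 (s, t)) (\<lambda>t. H2 (s, t)) (\<lambda>t. H3 (s, t)) a b) \<and>
        (\<forall>t. H1 (0, t) = x t \<and> H2 (0, t) = y t \<and> H3 (0, t) = z t) \<and>
        (\<forall>t. H3 (1, t) = 0))"

text \<open>Two arcs P([a0,a1]) and P([b0,b1]) of pr(K) (P = (x,y)) with disjoint interiors,
  joining two distinct crossings q1, q2 (meeting in different branches there), whose union
  is a null-homotopic loop, i.e. lifts to a closed loop in R^2.  Either both arcs run from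
  q1 to q2 (parallel) or in opposite directions (antiparallel).\<close>
definition arc_path :: "(real \<Rightarrow> real) \<Rightarrow> (real \<Rightarrow> real) \<Rightarrow> real \<Rightarrow> real \<Rightarrow> real \<times> real \<Rightarrow> real \<Rightarrow> real \<times> real" where
  "arc_path x y u0 u1 c = (\<lambda>\<tau>. (x (u0 + \<tau> * (u1 - u0)), y (u0 + \<tau> * (u1 - u0))) + c)"

definition arcs_ok :: "real \<Rightarrow> real \<Rightarrow> real \<Rightarrow> real \<Rightarrow> bool" where
  "arcs_ok a0 a1 b0 b1 \<longleftrightarrow> a0 < a1 \<and> b0 < b1 \<and>
     (\<forall>s \<in> {a0<..<a1}. \<forall>t \<in> {b0<..<b1}. s - t \<notin> \<int>)"

definition parallel_2gon :: "(real \<Rightarrow> real) \<Rightarrow> (real \<Rightarrow> real) \<Rightarrow> real \<Rightarrow> real \<Rightarrow> real \<Rightarrow> real \<Rightarrow> bool" where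
  "parallel_2gon x y a0 a1 b0 b1 \<longleftrightarrow> arcs_ok a0 a1 b0 b1 \<and>
     is_crossing x y a0 b0 \<and> is_crossing x y a1 b1 \<and> \<not> tor_eq (x a0, y a0) (x a1, y a1) \<and>
     (x a1 - x a0, y a1 - y a0) = (x b1 - x b0, y b1 - y b0)"

definition antiparallel_2gon :: "(real \<Rightarrow> real) \<Rightarrow> (real \<Rightarrow> real) \<Rightarrow> real \<Rightarrow> real \<Rightarrow> real \<Rightarrow> real \<Rightarrow> bool" where
  "antiparallel_2gon x y a0 a1 b0 b1 \<longleftrightarrow> arcs_ok a0 a1 b0 b1 \<and>
     is_crossing x y a0 b1 \<and> is_crossing x y a1 b0 \<and> \<not> tor_eq (x a0, y a0) (x a1, y a1) \<and>
     (x a1 - x a0, y a1 - y a0) + (x b1 - x b0, y b1 - y b0) = 0"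

definition has_2gon :: "(real \<Rightarrow> real) \<Rightarrow> (real \<Rightarrow> real) \<Rightarrow> bool" where
  "has_2gon x y \<longleftrightarrow> (\<exists>a0 a1 b0 b1. parallel_2gon x y a0 a1 b0 b1 \<or> antiparallel_2gon x y a0 a1 b0 b1)"

definition lifted_image :: "(real \<Rightarrow> real) \<Rightarrow> (real \<Rightarrow> real) \<Rightarrow> (real \<times> real) set" where
  "lifted_image x y = {(x t + of_int m, y t + of_int n) | t m n. True}"

text \<open>A Reidemeister II move decreasing the number of crossings can be performed: there is a
  2-gon whose lifted boundary loop is a simple closed curve bounding a disc whose interior
  meets no strand of pr(K), and one of the two arcs is the over-strand at both corners.\<close>
definition RII_reducible :: "(real \<Rightarrow> real) \<Rightarrow> (real \<Rightarrow> real) \<Rightarrow> (real \<Rightarrow> real) \<Rightarrow> bool" where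
  "RII_reducible x y z \<longleftrightarrow>
     (\<exists>a0 a1 b0 b1.
        (parallel_2gon x y a0 a1 b0 b1 \<and>
         (let g = arc_path x y a0 a1 0 +++
                  reversepath (arc_path x y b0 b1 ((x a0, y a0) - (x b0, y b0)))
          in simple_path g \<and> inside (path_image g) \<inter> lifted_image x y = {}) \<and>
         ((z a0 > z b0 \<and> z a1 > z b1) \<or> (z a0 < z b0 \<and> z a1 < z b1)))
      \<or> (antiparallel_2gon x y a0 a1 b0 b1 \<and>
         (let g = arc_path x y a0 a1 0 +++
                  arc_path x y b0 b1 ((x a1, y a1) - (x b0, y b0))
          in simple_path g \<and> inside (path_image g) \<inter> lifted_image x y = {}) \<and>
         ((z a0 > z b1 \<and> z a1 > z b0) \<or> (z a0 < z b1 \<and> z a1 < z b0))))"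

end

theory Submission
  imports Defs
begin

(* Since x' > 0 and x (t + 1) = x t + a, the map x is a bijection of \<real> and the lift of pr(K)
   to \<real>\<^sup>2 is the graph of g = y \<circ> x\<inverse>, with g (u + a) = g u + b.  A crossing with
   class (m, n) is then a zero of the gap function u \<mapsto> g (u + m) - g u - n, where a does not
   divide m; shifting the second preimage we may take 2 |m| \<le> a, and transversality makes the
   zero w simple.  Two zeros p < q of the same gap with q - p \<le> |m| bound a parallel 2-gon.
   If w had no other zero within distance |m|, the gap would have opposite signs at w + m and
   w - m, so the doubled gap g (u + 2m) - g u - 2n would change sign between w - m and w and
   vanish there: a crossing whose class is 2 (m, n) = 0 in G, against Z/2-purity.  Purity also
   keeps the two corners of the 2-gon apart. *)

lemma smooth_has_real_derivative:
  fixes f :: "real \<Rightarrow> real"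
  assumes "smooth f"
  shows "DERIV f t :> deriv f t"
proof -
  have "Ck (Suc 0) f"
    using assms unfolding smooth_def by blast
  then have "f differentiable at t"
    unfolding differentiable_def by auto
  then show ?thesis
    by (rule DERIV_deriv_iff_real_differentiable[THEN iffD2])
qed

lemma shift_by_int:
  fixes f :: "real \<Rightarrow> real"
  assumes "\<And>t. f (t + 1) = f t + c"
  shows "f (t + of_int k) = f t + of_int k * c"
proof (induction k rule: int_induct[where k = 0])
  case (step1 i)
  with assms[of "t + of_int i"] show ?case
    by (simp add: algebra_simps)
next
  case (step2 i)
  with assms[of "t + of_int (i - 1)"] show ?case
    by (simp add: algebra_simps)
qed simp

lemma IVT_sign_change:
  fixes f :: "real \<Rightarrow> real"
  assumes "\<And>v. isCont f v" and "p \<le> q" and "f p * f q \<le> 0"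
  obtains w where "p \<le> w" "w \<le> q" "f w = 0"
proof -
  have "f p \<le> 0 \<and> 0 \<le> f q \<or> 0 \<le> f p \<and> f q \<le> 0"
    using assms(3) by (auto simp: mult_le_0_iff)
  then show ?thesis
    using IVT[of f p 0 q] IVT2[of f q 0 p] assms(1,2) that by blast
qed

lemma simple_zero_pos_right:
  fixes f :: "real \<Rightarrow> real"
  assumes cont: "\<And>v. isCont f v" and zero: "f w = 0"
    and der: "DERIV f w :> d" and "d > 0" and "r > 0"
    and no_zero: "\<And>v. w < v \<Longrightarrow> v \<le> w + r \<Longrightarrow> f v \<noteq> 0"
  shows "f (w + r) > 0"
proof (rule ccontr)
  assume "\<not> f (w + r) > 0"
  obtain e where "e > 0" and inc: "\<And>h. 0 < h \<Longrightarrow> h < e \<Longrightarrow> f w < f (w + h)"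
    using DERIV_pos_inc_right[OF der \<open>d > 0\<close>] by blast
  define h where "h = min (e / 2) r"
  have h: "0 < h" "h \<le> r" "h < e"
    unfolding h_def using \<open>e > 0\<close> \<open>r > 0\<close> by auto
  have "f (w + h) * f (w + r) \<le> 0"
    using inc[OF h(1,3)] zero \<open>\<not> f (w + r) > 0\<close> by (simp add: mult_nonneg_nonpos)
  then obtain v where "w + h \<le> v" "v \<le> w + r" "f v = 0"
    using IVT_sign_change[OF cont, of "w + h" "w + r"] h(2) by auto
  then show False
    using no_zero h(1) by force
qed

lemma simple_zero_sign_right:
  fixes f :: "real \<Rightarrow> real"
  assumes cont: "\<And>v. isCont f v" and zero: "f w = 0"
    and der: "DERIV f w :> d" and "d \<noteq> 0" and "r > 0"
    and no_zero: "\<And>v. w < v \<Longrightarrow> v \<le> w + r \<Longrightarrow> f v \<noteq> 0"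
  shows "d * f (w + r) > 0"
proof (cases "d > 0")
  case True
  then show ?thesis
    using simple_zero_pos_right[OF cont zero der True \<open>r > 0\<close> no_zero] by simp
next
  case False
  have "- f (w + r) > 0"
    by (rule simple_zero_pos_right[where d = "- d"])
       (use assms False in \<open>auto intro: DERIV_minus\<close>)
  with False \<open>d \<noteq> 0\<close> show ?thesis
    by (simp add: zero_less_mult_iff)
qed

lemma simple_zero_sign_change:
  fixes f :: "real \<Rightarrow> real"
  assumes cont: "\<And>v. isCont f v" and zero: "f w = 0"
    and der: "DERIV f w :> d" and "d \<noteq> 0" and "r > 0"
    and no_zero: "\<And>v. v \<noteq> w \<Longrightarrow> \<bar>v - w\<bar> \<le> r \<Longrightarrow> f v \<noteq> 0"
  shows "f (w + r) * f (w - r) < 0"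
proof -
  have right: "d * f (w + r) > 0"
    by (rule simple_zero_sign_right[OF cont zero der \<open>d \<noteq> 0\<close> \<open>r > 0\<close>]) (use no_zero in auto)
  have "DERIV (\<lambda>v. f (2 * w - v)) w :> d * - 1"
    by (rule DERIV_chain2[where f = f]) (use der in \<open>auto intro!: derivative_eq_intros\<close>)
  then have "- d * f (2 * w - (w + r)) > 0"
    by (intro simple_zero_sign_right[where f = "\<lambda>v. f (2 * w - v)"])
       (use assms in \<open>auto intro: continuous_intros isCont_o2[where g = f]\<close>)
  then have left: "d * f (w - r) < 0"
    by simp
  from right left show ?thesis
    by (simp add: zero_less_mult_iff mult_less_0_iff) linarith
qed

lemma centered_representative:
  fixes a m :: int
  assumes "a > 0"
  obtains k where "2 * \<bar>m + k * a\<bar> \<le> a"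
proof (cases "2 * (m mod a) \<le> a")
  case True
  have "m + - (m div a) * a = m mod a"
    by (simp add: minus_div_mult_eq_mod)
  with True assms show ?thesis
    by (intro that[of "- (m div a)"]) simp
next
  case False
  have "m + (- (m div a) - 1) * a = m mod a - a"
    by (simp add: algebra_simps minus_div_mult_eq_mod)
  moreover have "2 * \<bar>m mod a - a\<bar> \<le> a"
    using False pos_mod_bound[OF assms, of m] by (auto simp: abs_if)
  ultimately show ?thesis
    by (intro that[of "- (m div a) - 1"]) simp
qed

lemma abs_le_abs_add_mult:
  fixes r a k :: int
  assumes "2 * \<bar>r\<bar> \<le> a"
  shows "\<bar>r\<bar> \<le> \<bar>r + k * a\<bar>"
proof (cases "k = 0")
  case False
  then have "1 * a \<le> \<bar>k\<bar> * a"
    using assms by (intro mult_right_mono) auto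
  then have "a \<le> \<bar>k * a\<bar>"
    using assms by (simp add: abs_mult)
  with assms show ?thesis
    by arith
qed simp

lemma generate_singleton_DirProd_integer:
  "v \<in> generate Z2grp {(a, b)} \<Longrightarrow> \<exists>k. v = (k * a, k * b)"
proof (induction v rule: generate.induct)
  case one
  then show ?case by (auto intro: exI[of _ 0])
next
  case (incl h)
  then show ?case by (auto intro: exI[of _ 1])
next
  case (inv h)
  then show ?case by (auto intro: exI[of _ "- 1"] simp: inv_DirProd)
next
  case (eng h1 h2)
  then show ?case by (auto intro: exI[of _ "_ + _"] simp: distrib_right)
qed

lemma iso_integer_group_square_eq_one:
  assumes "group G" and "G \<cong> integer_group"
    and "c \<in> carrier G" and "c \<otimes>\<^bsub>G\<^esub> c = \<one>\<^bsub>G\<^esub>"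
  shows "c = \<one>\<^bsub>G\<^esub>"
proof -
  obtain \<phi> where hom: "\<phi> \<in> hom G integer_group"
    and bij: "bij_betw \<phi> (carrier G) (carrier integer_group)"
    using assms(2) unfolding is_iso_def iso_def by auto
  have one: "\<phi> \<one>\<^bsub>G\<^esub> = 0"
    using hom_one[OF hom assms(1) group_integer_group] by simp
  have "\<phi> c + \<phi> c = \<phi> \<one>\<^bsub>G\<^esub>"
    using hom_mult[OF hom assms(3,3)] assms(4) by simp
  with one have "\<phi> c = \<phi> \<one>\<^bsub>G\<^esub>"
    by simp
  then show ?thesis
    using bij assms(1,3) group.is_monoid unfolding bij_betw_def inj_on_def
    by (metis monoid.one_closed)
qed

lemma Z2grp_quotient_integer_imp_odd:
  assumes iso: "(Z2grp Mod generate Z2grp {(a, b)}) \<cong> integer_group" and "a \<noteq> 0"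
  shows "odd a \<or> odd b"
proof (rule ccontr)
  assume "\<not> (odd a \<or> odd b)"
  then obtain a' b' where ab: "a = 2 * a'" "b = 2 * b'"
    by (auto elim!: evenE)
  let ?H = "generate Z2grp {(a, b)}"
  have grp: "group Z2grp"
    by (simp add: DirProd_group)
  interpret N: normal ?H Z2grp
    by (rule group.normal_generateI[OF grp]) (auto simp: inv_DirProd)
  define c where "c = ?H #>\<^bsub>Z2grp\<^esub> (a', b')"
  have c: "c \<in> carrier (Z2grp Mod ?H)"
    unfolding c_def FactGroup_def by (auto intro!: group.rcosetsI[OF grp] N.subset)
  have "c \<otimes>\<^bsub>Z2grp Mod ?H\<^esub> c = ?H #>\<^bsub>Z2grp\<^esub> (a, b)"
    unfolding c_def mult_FactGroup by (subst N.rcos_sum) (auto simp: ab integer_group_def)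
  also have "\<dots> = ?H"
    by (rule N.rcos_const[OF grp]) (rule generate.incl, simp)
  finally have "c = ?H"
    using iso_integer_group_square_eq_one[OF N.factorgroup_is_group iso c] by simp
  moreover have "(a', b') \<in> c"
    unfolding c_def by (rule group.rcos_self[OF grp]) (auto intro: N.subgroup_axioms)
  ultimately obtain k where "(a', b') = (k * a, k * b)"
    using generate_singleton_DirProd_integer by blast
  with ab \<open>a \<noteq> 0\<close> have "1 = 2 * k"
    by (simp add: mult.left_commute)
  then show False
    by presburger
qed

locale global_diagram =
  fixes x y z :: "real \<Rightarrow> real" and a b :: int
  assumes global: "global_knot_diagram x y z a b"
begin

lemma
  shows x_DERIV: "DERIV x t :> deriv x t"
    and y_DERIV: "DERIV y t :> deriv y t"
    and x_shift_1: "x (t + 1) = x t + of_int a"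
    and y_shift_1: "y (t + 1) = y t + of_int b"
    and deriv_x_pos: "deriv x t > 0"
    and no_triple_point: "tor_eq (x r, y r) (x s, y s) \<Longrightarrow> tor_eq (x s, y s) (x t, y t)
      \<Longrightarrow> r - s \<in> \<int> \<or> s - t \<in> \<int> \<or> r - t \<in> \<int>"
    and crossing_transversal: "is_crossing x y s t
      \<Longrightarrow> deriv x s * deriv y t - deriv y s * deriv x t \<noteq> 0"
  using global smooth_has_real_derivative
  unfolding global_knot_diagram_def knot_embedding_def by blast+

lemma x_shift: "x (t + of_int k) = x t + of_int k * of_int a"
  by (rule shift_by_int) (rule x_shift_1)

lemma y_shift: "y (t + of_int k) = y t + of_int k * of_int b"
  by (rule shift_by_int) (rule y_shift_1)

lemma strict_mono_x: "strict_mono x"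
  by (rule strict_monoI, rule DERIV_pos_imp_increasing) (use x_DERIV deriv_x_pos in blast)+

lemma a_pos: "a > 0"
  using strict_monoD[OF strict_mono_x, of 0 1] x_shift_1[of 0] by simp

lemma surj_x: "surj x"
proof -
  have "\<exists>t. x t = u" for u
  proof -
    obtain k :: nat where k: "\<bar>u - x 0\<bar> \<le> of_nat k"
      using real_arch_simple by blast
    have "real k * 1 \<le> real k * of_int a"
      using a_pos by (intro mult_left_mono) auto
    then have "x (- of_nat k) \<le> u" "u \<le> x (of_nat k)"
      using x_shift[of 0 "- int k"] x_shift[of 0 "int k"] k by (simp_all add: abs_le_iff)
    then show ?thesis
      using IVT[of x "- of_nat k" u "of_nat k"] x_DERIV DERIV_isCont by force
  qed
  then show ?thesis
    by (metis surjI)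
qed

definition xi :: "real \<Rightarrow> real" where
  "xi = inv_into UNIV x"

lemma x_xi [simp]: "x (xi u) = u"
  unfolding xi_def by (rule surj_f_inv_f[OF surj_x])

lemma xi_x [simp]: "xi (x t) = t"
  unfolding xi_def by (rule inv_f_f[OF strict_mono_imp_inj_on[OF strict_mono_x]])

lemma xi_less_iff [simp]: "xi u < xi v \<longleftrightarrow> u < v"
  using strict_mono_less[OF strict_mono_x, of "xi u" "xi v"] by simp

lemma xi_shift: "xi (u + of_int k * of_int a) = xi u + of_int k"
proof -
  have "x (xi u + of_int k) = u + of_int k * of_int a"
    by (simp add: x_shift)
  from arg_cong[where f = xi, OF this] show ?thesis
    by simp
qed

lemma xi_diff_Ints_iff: "xi u - xi v \<in> \<int> \<longleftrightarrow> (\<exists>j::int. u = v + of_int j * of_int a)"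
proof
  assume "xi u - xi v \<in> \<int>"
  then obtain j where "xi u - xi v = of_int j"
    by (rule Ints_cases)
  then have "x (xi u) = x (xi v + of_int j)"
    by (simp add: algebra_simps)
  then have "u = v + of_int j * of_int a"
    by (simp add: x_shift)
  then show "\<exists>j::int. u = v + of_int j * of_int a" ..
qed (auto simp: xi_shift)

lemma xi_DERIV: "DERIV xi u :> inverse (deriv x (xi u))"
proof (rule DERIV_inverse_function[where f = x and a = "u - 1" and b = "u + 1"])
  show "deriv x (xi u) \<noteq> 0"
    using deriv_x_pos[of "xi u"] by simp
  have "isCont xi (x (xi u))"
    by (rule isCont_inverse_function[of 1]) (auto intro: x_DERIV DERIV_isCont)
  then show "isCont xi u"
    by simp
qed (auto intro: x_DERIV)

definition g :: "real \<Rightarrow> real" where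
  "g u = y (xi u)"

lemma g_shift: "g (u + of_int k * of_int a) = g u + of_int k * of_int b"
  unfolding g_def by (simp add: xi_shift y_shift)

lemma g_DERIV: "DERIV g u :> deriv y (xi u) / deriv x (xi u)"
  unfolding g_def[abs_def] divide_inverse
  by (rule DERIV_chain2[OF y_DERIV xi_DERIV])

(* A zero u of gap m n is a crossing between the strands above u and u + m whose loop
   K_p^+ has class (m, n). *)
definition gap :: "int \<Rightarrow> int \<Rightarrow> real \<Rightarrow> real" where
  "gap m n u = g (u + of_int m) - g u - of_int n"

lemma isCont_gap: "isCont (gap m n) u"
proof -
  have isCont_g: "isCont g v" for v
    by (rule DERIV_isCont[OF g_DERIV])
  have "isCont (\<lambda>v. g (v + of_int m)) u"
    by (rule isCont_o2[OF _ isCont_g]) (intro continuous_intros)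
  then show ?thesis
    unfolding gap_def[abs_def] by (intro continuous_intros isCont_g)
qed

lemma gap_DERIV:
  "DERIV (gap m n) u :> deriv y (xi (u + of_int m)) / deriv x (xi (u + of_int m))
                        - deriv y (xi u) / deriv x (xi u)"
proof -
  have "DERIV (\<lambda>v. g (v + of_int m)) u
          :> deriv y (xi (u + of_int m)) / deriv x (xi (u + of_int m)) * 1"
    by (rule DERIV_chain2[OF g_DERIV]) (auto intro!: derivative_eq_intros)
  from DERIV_diff[OF DERIV_diff[OF this g_DERIV] DERIV_const[of "of_int n"]] show ?thesis
    unfolding gap_def[abs_def] by simp
qed

lemma gap_double: "gap (2 * m) (2 * n) u = gap m n u + gap m n (u + of_int m)"
  unfolding gap_def by (simp add: add.assoc)

lemma gap_period_multiple: "gap (j * a) n u = of_int (j * b - n)"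
  unfolding gap_def using g_shift[of u j] by simp

lemma gap_zero_imp_crossing:
  assumes "\<not> a dvd m" and "gap m n u = 0"
  shows "is_crossing x y (xi u) (xi (u + of_int m))"
proof -
  have "xi u - xi (u + of_int m) \<notin> \<int>"
  proof
    assume "xi u - xi (u + of_int m) \<in> \<int>"
    then obtain j where "u = u + of_int m + of_int j * of_int a"
      by (auto simp: xi_diff_Ints_iff)
    then have "m = - j * a"
      by (simp flip: of_int_mult of_int_add)
    with assms(1) show False
      by simp
  qed
  moreover have "y (xi u) - y (xi (u + of_int m)) = - of_int n"
    using assms(2) unfolding gap_def g_def by simp
  ultimately show ?thesis
    unfolding is_crossing_def tor_eq_def by simp
qed

lemma gap_zero_simple:
  assumes "\<not> a dvd m" and "gap m n u = 0"
  obtains d where "DERIV (gap m n) u :> d" and "d \<noteq> 0"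
proof
  let ?s = "xi u" and ?t = "xi (u + of_int m)"
  have "deriv x ?s * deriv y ?t - deriv y ?s * deriv x ?t \<noteq> 0"
    by (rule crossing_transversal[OF gap_zero_imp_crossing[OF assms]])
  moreover have "deriv x ?s > 0" "deriv x ?t > 0"
    using deriv_x_pos by blast+
  ultimately show "deriv y ?t / deriv x ?t - deriv y ?s / deriv x ?s \<noteq> 0"
    by (simp add: field_simps)
qed (rule gap_DERIV)

lemma crossing_imp_gap_zero:
  assumes "is_crossing x y s t"
  obtains m n where "\<not> a dvd m" and "2 * \<bar>m\<bar> \<le> a" and "gap m n (x s) = 0"
proof -
  have "x t - x s \<in> \<int>" "y t - y s \<in> \<int>"
    using assms unfolding is_crossing_def tor_eq_def
    by (metis Ints_minus minus_diff_eq fst_conv snd_conv)+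
  then obtain m0 n0 where m0: "x t = x s + of_int m0" and n0: "y t = y s + of_int n0"
    by (auto elim!: Ints_cases simp: algebra_simps)
  obtain k where centered: "2 * \<bar>m0 + k * a\<bar> \<le> a"
    using centered_representative[OF a_pos] by blast
  define t' where "t' = t + of_int k"
  have x_t': "x t' = x s + of_int (m0 + k * a)" and y_t': "y t' = y s + of_int (n0 + k * b)"
    unfolding t'_def using m0 n0 by (simp_all add: x_shift y_shift)
  have "\<not> a dvd m0 + k * a"
  proof
    assume "a dvd m0 + k * a"
    then obtain j where j: "m0 + k * a = j * a"
      by (metis dvd_def mult.commute)
    then have "x t' = x s + of_int j * of_int a"
      using x_t' unfolding j by simp
    then have "xi (x t') - xi (x s) \<in> \<int>"
      unfolding xi_diff_Ints_iff by blast
    then have "t' - s \<in> \<int>"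
      by simp
    then have "- (t' - s) + of_int k \<in> \<int>"
      by (intro Ints_add Ints_minus) auto
    with assms show False
      unfolding is_crossing_def t'_def by (simp add: algebra_simps)
  qed
  moreover have "gap (m0 + k * a) (n0 + k * b) (x s) = 0"
    unfolding gap_def g_def x_t'[symmetric] using y_t' by simp
  ultimately show ?thesis
    using centered that by blast
qed

lemma arcs_ok_translate:
  assumes "2 * \<bar>m\<bar> \<le> a" and "p < q" and "q - p \<le> \<bar>of_int m\<bar>"
  shows "arcs_ok (xi p) (xi q) (xi (p + of_int m)) (xi (q + of_int m))"
  unfolding arcs_ok_def
proof (intro conjI ballI notI)
  fix s t
  assume s: "s \<in> {xi p<..<xi q}" and t: "t \<in> {xi (p + of_int m)<..<xi (q + of_int m)}"
    and "s - t \<in> \<int>"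
  then obtain j where j: "x s = x t + of_int j * of_int a"
    using xi_diff_Ints_iff[of "x s" "x t"] by auto
  have "x (xi p) < x s" "x s < x (xi q)"
    and "x (xi (p + of_int m)) < x t" "x t < x (xi (q + of_int m))"
    using s t by (simp_all add: strict_mono_less[OF strict_mono_x] del: x_xi)
  then have "p < x s" "x s < q" "p + of_int m < x t" "x t < q + of_int m"
    by simp_all
  then have "\<bar>of_int (m + j * a)\<bar> < \<bar>real_of_int m\<bar>"
    using j assms(3) by (simp add: abs_less_iff)
  then have "\<bar>m + j * a\<bar> < \<bar>m\<bar>"
    by linarith
  with abs_le_abs_add_mult[OF assms(1)] show False
    by (simp add: not_le[symmetric])
qed (use assms in auto)

end

locale pure_global_diagram = global_diagram +
  assumes pure: "Z2_pure x y a b"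
begin

lemma odd_a_or_odd_b: "odd a \<or> odd b"
  using pure a_pos Z2grp_quotient_integer_imp_odd unfolding Z2_pure_def by auto

lemma gap_zero_nonzero_in_G:
  assumes "\<not> a dvd m" and "gap m n u = 0"
  shows "nonzero_in_G a b m n"
proof -
  have "x (xi (u + of_int m)) - x (xi u) = of_int m" "y (xi (u + of_int m)) - y (xi u) = of_int n"
    using assms(2) unfolding gap_def g_def by simp_all
  with pure gap_zero_imp_crossing[OF assms] show ?thesis
    unfolding Z2_pure_def by blast
qed

(* A zero would be a crossing whose class (2 m - j a, 2 n - j b) vanishes in G, or, when a
   divides 2 m - j a, would force a and b to be both even. *)
lemma gap_double_class_nonzero:
  assumes "\<not> a dvd m"
  shows "gap (2 * m - j * a) (2 * n - j * b) u \<noteq> 0"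
proof
  assume zero: "gap (2 * m - j * a) (2 * n - j * b) u = 0"
  show False
  proof (cases "a dvd 2 * m - j * a")
    case True
    then obtain l where l: "2 * m - j * a = l * a"
      by (metis dvd_def mult.commute)
    have "real_of_int (l * b - (2 * n - j * b)) = 0"
      using zero unfolding l gap_period_multiple .
    then have "2 * n - j * b = l * b"
      unfolding of_int_eq_0_iff by linarith
    with l have "2 * m = (l + j) * a" "2 * n = (l + j) * b"
      by (simp_all add: algebra_simps)
    moreover have "odd (l + j)"
    proof
      assume "even (l + j)"
      then obtain c where "l + j = 2 * c" ..
      with \<open>2 * m = (l + j) * a\<close> have "m = c * a"
        by simp
      with assms show False
        by simp
    qed
    ultimately show False
      using odd_a_or_odd_b by (metis dvd_triv_left even_mult_iff)
  next
    case False
    from this zero have "nonzero_in_G a b (2 * m - j * a) (2 * n - j * b)"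
      by (rule gap_zero_nonzero_in_G)
    then show False
      unfolding nonzero_in_G_def by (auto intro: exI[of _ "- j"])
  qed
qed

lemma gap_zero_nearby:
  assumes "\<not> a dvd m" and zero: "gap m n w = 0"
  obtains v where "v \<noteq> w" and "\<bar>v - w\<bar> \<le> \<bar>of_int m\<bar>" and "gap m n v = 0"
proof (rule ccontr)
  assume "\<not> thesis"
  then have no_zero: "\<And>v. v \<noteq> w \<Longrightarrow> \<bar>v - w\<bar> \<le> \<bar>of_int m\<bar> \<Longrightarrow> gap m n v \<noteq> 0"
    using that by blast
  obtain d where "DERIV (gap m n) w :> d" "d \<noteq> 0"
    using gap_zero_simple[OF assms] .
  moreover have "\<bar>real_of_int m\<bar> > 0"
    using assms(1) by auto
  ultimately have "gap m n (w + \<bar>of_int m\<bar>) * gap m n (w - \<bar>of_int m\<bar>) < 0"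
    using simple_zero_sign_change[OF isCont_gap zero] no_zero by blast
  moreover have "gap (2 * m) (2 * n) w = gap m n (w + of_int m)"
    and "gap (2 * m) (2 * n) (w - of_int m) = gap m n (w - of_int m)"
    using gap_double[of m n w] gap_double[of m n "w - of_int m"] zero by simp_all
  ultimately have "gap (2 * m) (2 * n) w * gap (2 * m) (2 * n) (w - of_int m) \<le> 0"
    by (cases "m \<ge> 0") (simp_all add: mult.commute)
  then obtain v where "gap (2 * m) (2 * n) v = 0"
    using IVT_sign_change[OF isCont_gap, of w "w - of_int m"]
      IVT_sign_change[OF isCont_gap, of "w - of_int m" w]
    by (metis linear mult.commute)
  with gap_double_class_nonzero[OF assms(1), of 0 n v] show False
    by simp
qed

lemma gap_zeros_corners_distinct:
  assumes "\<not> a dvd m" and "2 * \<bar>m\<bar> \<le> a" and "p < q" and "q - p \<le> \<bar>of_int m\<bar>"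
    and zero_p: "gap m n p = 0" and zero_q: "gap m n q = 0"
  shows "\<not> tor_eq (p, g p) (q, g q)"
proof
  assume corners: "tor_eq (p, g p) (q, g q)"
  have "tor_eq (x (xi p), y (xi p)) (x (xi (p + of_int m)), y (xi (p + of_int m)))"
    using gap_zero_imp_crossing[OF assms(1) zero_p] unfolding is_crossing_def by simp
  moreover have "tor_eq (x (xi (p + of_int m)), y (xi (p + of_int m))) (x (xi q), y (xi q))"
  proof -
    have "x (xi (p + of_int m)) - x (xi q) = (p - q) + of_int m"
      and "y (xi (p + of_int m)) - y (xi q) = (g p - g q) + of_int n"
      using zero_p unfolding gap_def g_def by simp_all
    moreover have "p - q \<in> \<int>" "g p - g q \<in> \<int>"
      using corners unfolding tor_eq_def by simp_all
    ultimately show ?thesis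
      unfolding tor_eq_def fst_conv snd_conv using Ints_add Ints_of_int by metis
  qed
  ultimately have "xi (p + of_int m) - xi q \<in> \<int> \<or> xi p - xi q \<in> \<int>"
    using no_triple_point gap_zero_imp_crossing[OF assms(1) zero_p]
    unfolding is_crossing_def by blast
  then show False
  proof
    assume "xi (p + of_int m) - xi q \<in> \<int>"
    then obtain j where j: "p + of_int m = q + of_int j * of_int a"
      by (auto simp: xi_diff_Ints_iff)
    then have "g (p + of_int m) = g q + of_int j * of_int b"
      by (simp add: g_shift)
    moreover have "p + of_int (2 * m - j * a) = q + of_int m"
      using j by simp
    ultimately have "gap (2 * m - j * a) (2 * n - j * b) p = 0"
      using zero_p zero_q unfolding gap_def
      by (simp only: of_int_diff of_int_mult of_int_numeral)
    with gap_double_class_nonzero[OF assms(1)] show False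
      by blast
  next
    assume "xi p - xi q \<in> \<int>"
    then obtain j where "p = q + of_int j * of_int a"
      by (auto simp: xi_diff_Ints_iff)
    with assms(2-4) have "j * a < 0" "- \<bar>m\<bar> \<le> j * a"
      by (simp_all flip: of_int_mult)
    moreover from \<open>j * a < 0\<close> have "j \<le> - 1"
      using a_pos by (simp add: mult_less_0_iff)
    then have "j * a \<le> - 1 * a"
      using a_pos by (intro mult_right_mono) auto
    ultimately show False
      using assms(2) a_pos by linarith
  qed
qed

lemma gap_zeros_parallel_2gon:
  assumes "\<not> a dvd m" and "2 * \<bar>m\<bar> \<le> a" and "p < q" and "q - p \<le> \<bar>of_int m\<bar>"
    and "gap m n p = 0" and "gap m n q = 0"
  shows "parallel_2gon x y (xi p) (xi q) (xi (p + of_int m)) (xi (q + of_int m))"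
  using arcs_ok_translate[OF assms(2-4)] gap_zero_imp_crossing[OF assms(1)] assms(5,6)
    gap_zeros_corners_distinct[OF assms]
  unfolding parallel_2gon_def gap_def g_def by simp

end

theorem mainTheorem6:
  fixes x y z :: "real \<Rightarrow> real" and a b :: int
  assumes "global_knot_diagram x y z a b"
    and "Z2_pure x y a b"
    and "\<not> isotopic_to_flat x y z a b"
    and "\<exists>s t. is_crossing x y s t"
    and "\<not> RII_reducible x y z"
  shows "has_2gon x y"
proof -
  interpret pure_global_diagram x y z a b
    using assms(1,2) by unfold_locales
  obtain s t where "is_crossing x y s t"
    using assms(4) by blast
  then obtain m n where m: "\<not> a dvd m" "2 * \<bar>m\<bar> \<le> a" and zero: "gap m n (x s) = 0"
    by (rule crossing_imp_gap_zero)
  from m(1) zero obtain v where "v \<noteq> x s" "\<bar>v - x s\<bar> \<le> \<bar>of_int m\<bar>" "gap m n v = 0"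
    by (rule gap_zero_nearby)
  then obtain p q where "p < q" "q - p \<le> \<bar>of_int m\<bar>" "gap m n p = 0" "gap m n q = 0"
    using zero by (cases "v < x s") (auto intro!: that[of v "x s"] that[of "x s" v])
  with m have "parallel_2gon x y (xi p) (xi q) (xi (p + of_int m)) (xi (q + of_int m))"
    by (intro gap_zeros_parallel_2gon)
  then show ?thesis
    unfolding has_2gon_def by blast
qed

end
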